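(* Let $M=(E,r)$ be a $q$-matroid and let $E'=E\oplus\ell$ with $\ell$ a $1$-dimensional space. For every subspace $A'\subseteq E'$ let $A\subseteq E$ be the unique subspace of $E$ such that $A'+\ell=A\oplus\ell$, and put $r'(A')=r(A)$. Then $M'=M\oplus\ell:=(E',r')$ is a $q$-matroid, that is, $r'$ satisfies the rank axioms (R1), (R2), (R3).
   Context: A $q$-matroid is a pair $(E,r)$, where $E$ is a finite-dimensional vector space over a field and $r$ is an integer-valued function on the set of subspaces of $E$ such that: (R1) $0\le r(A)\le\dim A$ for all $A$; (R2) $A\subseteq B$ implies $r(A)\le r(B)$; (R3) $r(A+B)+r(A\cap B)\le r(A)+r(B)$ for all $A,B$. *)

theory Defs
  imports Main "HOL.Vector_Spaces" "HOL-Library.Set_Algebras"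
begin

text \<open>
  Vector spaces are subspaces of an ambient \<^locale>\<open>vector_space\<close> over an arbitrary field; the
  ambient space may be infinite-dimensional. Sums of subspaces are the elementwise sums of
  \<^theory>\<open>HOL-Library.Set_Algebras\<close>. A rank function is a function on all sets, of which only the
  values on subspaces of \<open>E\<close> matter.
\<close>

locale q_matroid = vector_space scale
  for scale :: "'a::field \<Rightarrow> 'b::ab_group_add \<Rightarrow> 'b" +
  fixes E :: "'b set" and r :: "'b set \<Rightarrow> int"
  assumes subspace_ground: "subspace E"
    and finite_dim_ground: "\<exists>B. finite B \<and> span B = E"
    and R1: "\<And>A. subspace A \<Longrightarrow> A \<subseteq> E \<Longrightarrow> 0 \<le> r A \<and> r A \<le> int (dim A)"
    and R2: "\<And>A B. subspace A \<Longrightarrow> subspace B \<Longrightarrow> B \<subseteq> E \<Longrightarrow> A \<subseteq> B \<Longrightarrow> r A \<le> r B"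
    and R3: "\<And>A B. subspace A \<Longrightarrow> A \<subseteq> E \<Longrightarrow> subspace B \<Longrightarrow> B \<subseteq> E \<Longrightarrow>
               r (A + B) + r (A \<inter> B) \<le> r A + r B"

context vector_space
begin

text \<open>\<open>W = U \<oplus> V\<close> as an internal direct sum of subspaces.\<close>

definition is_direct_sum :: "'b set \<Rightarrow> 'b set \<Rightarrow> 'b set \<Rightarrow> bool" where
  "is_direct_sum W U V \<longleftrightarrow> subspace U \<and> subspace V \<and> U \<inter> V = {0} \<and> W = U + V"

definition proj_part :: "'b set \<Rightarrow> 'b set \<Rightarrow> 'b set \<Rightarrow> 'b set" where
  "proj_part E l A' = (THE A. subspace A \<and> A \<subseteq> E \<and> is_direct_sum (A' + l) A l)"

definition sum_rank :: "'b set \<Rightarrow> ('b set \<Rightarrow> int) \<Rightarrow> 'b set \<Rightarrow> 'b set \<Rightarrow> int" where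
  "sum_rank E r l A' = r (proj_part E l A')"

end

end

theory Submission
  imports Defs
begin

text \<open>
  The subspace \<open>A\<close> attached to \<open>A'\<close> is the image of \<open>A'\<close> under the projection \<open>\<pi>\<close> of
  \<open>E \<oplus> l\<close> onto \<open>E\<close> along \<open>l\<close>; as a set it is \<open>(A' + l) \<inter> E\<close>, which by the modular law
  is the only complement of \<open>l\<close> in \<open>A' + l\<close> that lies in \<open>E\<close>. So the new rank is \<open>r \<circ> \<pi>\<close>,
  and the axioms are inherited because taking images under a linear map does not raise the dimension
  (lemma \<open>dim_proj_le\<close>), preserves inclusions (lemma \<open>proj_mono\<close>) and commutes with sums
  (lemma \<open>proj_sum\<close>). For intersections there is only the inclusion
  \<open>\<pi> (A \<inter> B) \<subseteq> \<pi> A \<inter> \<pi> B\<close>, but monotonicity of \<open>r\<close> makes it act in the right direction: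
  \<open>r (\<pi> (A + B)) + r (\<pi> (A \<inter> B)) \<le> r (\<pi> A + \<pi> B) + r (\<pi> A \<inter> \<pi> B) \<le> r (\<pi> A) + r (\<pi> B)\<close>.
\<close>

context vector_space
begin

lemma subspace_set_plus:
  assumes "subspace U" "subspace V"
  shows "subspace (U + V)"
proof -
  have "U + V = {x + y |x y. x \<in> U \<and> y \<in> V}"
    by (auto simp: set_plus_def)
  with subspace_sums[OF assms] show ?thesis by simp
qed

lemma subset_set_plus_left: "subspace V \<Longrightarrow> U \<subseteq> U + V"
  using set_plus_intro[of _ U 0 V] by (force simp: subspace_0)

lemma subset_set_plus_right: "subspace U \<Longrightarrow> V \<subseteq> U + V"
  using subset_set_plus_left[of U V] by (simp add: add.commute)

lemma set_plus_least:
  assumes "subspace W" "U \<subseteq> W" "V \<subseteq> W"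
  shows "U + V \<subseteq> W"
  using assms by (auto elim!: set_plus_elim intro: subspace_add)

lemma set_plus_self: "subspace U \<Longrightarrow> U + U = U"
  by (intro equalityI set_plus_least subset_set_plus_left) auto

text \<open>
  Two cases of the modular law. The first makes the complement of \<open>l\<close> that lies in \<open>E\<close> unique,
  since it recovers \<open>A\<close> from \<open>A + l\<close>; the second shows that \<open>W \<inter> E\<close> is such a complement in \<open>W\<close>.
\<close>

lemma set_plus_Int_cancel:
  assumes E: "subspace E" and l: "subspace l" and El: "E \<inter> l = {0}" and A: "A \<subseteq> E"
  shows "(A + l) \<inter> E = A"
proof
  show "(A + l) \<inter> E \<subseteq> A"
  proof
    fix x assume "x \<in> (A + l) \<inter> E"
    then obtain a y where x: "x = a + y" "a \<in> A" "y \<in> l" "x \<in> E"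
      by (auto elim: set_plus_elim)
    have "x - a \<in> E" using x A by (intro subspace_diff E) auto
    hence "y = 0" using x El by auto
    with x show "x \<in> A" by simp
  qed
  show "A \<subseteq> (A + l) \<inter> E"
    using A subset_set_plus_left[OF l] by auto
qed

lemma Int_set_plus_modular:
  assumes l: "subspace l" and W: "subspace W" "l \<subseteq> W" "W \<subseteq> E + l"
  shows "W \<inter> E + l = W"
proof
  show "W \<inter> E + l \<subseteq> W"
    using W by (intro set_plus_least) auto
  show "W \<subseteq> W \<inter> E + l"
  proof
    fix x assume x: "x \<in> W"
    then obtain e y where e: "x = e + y" "e \<in> E" "y \<in> l"
      using W by (blast elim: set_plus_elim)
    have "x - y \<in> W" using x e W by (intro subspace_diff) auto
    with e show "x \<in> W \<inter> E + l" by (auto intro: set_plus_intro)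
  qed
qed

lemma complement_iff:
  assumes D: "is_direct_sum E' E l" and A': "subspace A'" "A' \<subseteq> E'"
  shows "subspace A \<and> A \<subseteq> E \<and> is_direct_sum (A' + l) A l \<longleftrightarrow> A = (A' + l) \<inter> E"
proof
  have E: "subspace E" and l: "subspace l" and El: "E \<inter> l = {0}" and E': "E' = E + l"
    using D by (auto simp: is_direct_sum_def)
  show "A = (A' + l) \<inter> E" if "subspace A \<and> A \<subseteq> E \<and> is_direct_sum (A' + l) A l"
    using that set_plus_Int_cancel[OF E l El, of A] by (auto simp: is_direct_sum_def)
  show "subspace A \<and> A \<subseteq> E \<and> is_direct_sum (A' + l) A l" if A: "A = (A' + l) \<inter> E"
  proof -
    have W: "subspace (A' + l)" using A' l by (intro subspace_set_plus)
    have lW: "l \<subseteq> A' + l" using A' by (intro subset_set_plus_right)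
    have "A' + l \<subseteq> E + l"
      using A' E' by (intro set_plus_least subspace_set_plus subset_set_plus_right E l) auto
    hence "A + l = A' + l"
      unfolding A by (intro Int_set_plus_modular l W lW)
    moreover have "A \<inter> l = {0}"
      using A El lW W E l by (auto simp: subspace_0)
    ultimately show ?thesis
      using A W E l by (auto simp: is_direct_sum_def subspace_inter)
  qed
qed

lemma proj_part_eq:
  assumes "is_direct_sum E' E l" "subspace A'" "A' \<subseteq> E'"
  shows "proj_part E l A' = (A' + l) \<inter> E"
  unfolding proj_part_def complement_iff[OF assms] by simp

lemma proj_part_props:
  assumes "is_direct_sum E' E l" "subspace A'" "A' \<subseteq> E'"
  shows "subspace (proj_part E l A')" "proj_part E l A' \<subseteq> E" "proj_part E l A' + l = A' + l"
  using complement_iff[OF assms, of "proj_part E l A'"] proj_part_eq[OF assms]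
  by (auto simp: is_direct_sum_def)

lemma proj_mono:
  assumes D: "is_direct_sum E' E l"
    and "subspace A" "subspace B" "B \<subseteq> E'" "A \<subseteq> B"
  shows "proj_part E l A \<subseteq> proj_part E l B"
  using assms proj_part_eq[OF D, of A] proj_part_eq[OF D, of B] set_plus_mono2[of A B l l]
  by auto

text \<open>Both sides lie in \<open>E\<close> and have the same sum with \<open>l\<close>, because \<open>l + l = l\<close>.\<close>

lemma proj_sum:
  assumes D: "is_direct_sum E' E l"
    and A: "subspace A" "A \<subseteq> E'" and B: "subspace B" "B \<subseteq> E'"
  shows "proj_part E l (A + B) = proj_part E l A + proj_part E l B"
proof -
  have E: "subspace E" and l: "subspace l" and El: "E \<inter> l = {0}" and E': "subspace E'"
    using D by (auto simp: is_direct_sum_def subspace_set_plus)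
  let ?P = "proj_part E l"
  have PE: "?P A + ?P B \<subseteq> E"
    by (intro set_plus_least E proj_part_props(2)[OF D] A B)
  have AB: "subspace (A + B)" "A + B \<subseteq> E'"
    by (intro subspace_set_plus set_plus_least E' A B)+
  have "(X + Y) + l = (X + l) + (Y + l)" for X Y :: "'b set"
    using set_plus_self[OF l] by (metis add.assoc add.commute)
  hence "?P A + ?P B + l = (A + B) + l"
    using proj_part_props(3)[OF D A] proj_part_props(3)[OF D B] by metis
  with set_plus_Int_cancel[OF E l El PE] proj_part_eq[OF D AB]
  show ?thesis by simp
qed

text \<open>
  The components in \<open>E\<close> of the elements of a basis of \<open>A'\<close> span \<open>proj_part E l A'\<close>. The finite
  spanning set \<open>F\<close> guarantees that the basis is finite, so that its cardinality bounds dimensions.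
\<close>

lemma dim_proj_le:
  assumes D: "is_direct_sum E' E l" and A': "subspace A'" "A' \<subseteq> E'"
    and F: "finite F" "E' \<subseteq> span F"
  shows "dim (proj_part E l A') \<le> dim A'"
proof -
  have E: "subspace E" and l: "subspace l" and El: "E \<inter> l = {0}" and E': "E' = E + l"
    using D by (auto simp: is_direct_sum_def)
  obtain B where B: "B \<subseteq> A'" "independent B" "A' \<subseteq> span B" "card B = dim A'"
    using basis_exists .
  have "finite B"
    using independent_span_bound[OF F(1) B(2)] B(1) A'(2) F(2) by blast
  have "\<forall>b\<in>B. \<exists>e. e \<in> E \<and> b - e \<in> l"
  proof
    fix b assume "b \<in> B"
    then obtain e y where "b = e + y" "e \<in> E" "y \<in> l"
      using B(1) A'(2) E' by (blast elim: set_plus_elim)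
    thus "\<exists>e. e \<in> E \<and> b - e \<in> l" by auto
  qed
  then obtain p where p: "\<And>b. b \<in> B \<Longrightarrow> p b \<in> E" "\<And>b. b \<in> B \<Longrightarrow> b - p b \<in> l"
    by metis
  let ?S = "span (p ` B)"
  have SE: "?S \<subseteq> E" using p(1) E by (intro span_minimal) auto
  have sub: "subspace (?S + l)" using l by (intro subspace_set_plus) auto
  have "b \<in> ?S + l" if "b \<in> B" for b
  proof -
    have "p b \<in> ?S" using that by (intro span_base) simp
    from set_plus_intro[OF this p(2)[OF that]] show ?thesis by simp
  qed
  hence "A' \<subseteq> ?S + l"
    using B(3) span_minimal[OF _ sub, of B] by blast
  hence "A' + l \<subseteq> ?S + l"
    by (intro set_plus_least sub subset_set_plus_right) auto
  hence "proj_part E l A' \<subseteq> ?S"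
    using proj_part_eq[OF D A'] set_plus_Int_cancel[OF E l El SE] by auto
  hence "dim (proj_part E l A') \<le> card (p ` B)"
    using \<open>finite B\<close> by (intro dim_le_card) auto
  also have "\<dots> \<le> dim A'" using card_image_le[OF \<open>finite B\<close>] B(4) by metis
  finally show ?thesis .
qed

text \<open>
  In an ambient space of infinite dimension, \<open>dim\<close> is \<open>0\<close> on subspaces without a finite basis, so a
  positive value does certify finiteness.
\<close>

lemma finite_spanning_set_of_dim_pos:
  assumes "subspace U" "dim U > 0"
  shows "\<exists>B. finite B \<and> span B = U"
proof -
  obtain B where B: "B \<subseteq> U" "independent B" "U \<subseteq> span B" "card B = dim U"
    using basis_exists .
  have "finite B" using B(4) assms(2) card.infinite by fastforce
  moreover have "span B = U" using B(1,3) span_minimal[OF B(1) assms(1)] by blast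
  ultimately show ?thesis by blast
qed

end

theorem theorem41:
  fixes scale :: "'a::field \<Rightarrow> 'b::ab_group_add \<Rightarrow> 'b"
    and E E' l :: "'b set" and r :: "'b set \<Rightarrow> int"
  assumes "q_matroid scale E r"
    and "vector_space.is_direct_sum scale E' E l"
    and "vector_space.dim scale l = 1"
  shows "(\<forall>A'. module.subspace scale A' \<and> A' \<subseteq> E' \<longrightarrow>
            (\<exists>!A. module.subspace scale A \<and> A \<subseteq> E \<and>
                  vector_space.is_direct_sum scale (A' + l) A l)) \<and>
         q_matroid scale E' (vector_space.sum_rank scale E r l)"
proof -
  interpret q_matroid scale E r by fact
  note D = assms(2)
  have l: "subspace l" and E'_eq: "E' = E + l" and E': "subspace E'"
    using D by (auto simp: is_direct_sum_def subspace_set_plus)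
  obtain B where B: "finite B" "span B = E" using finite_dim_ground by blast
  obtain C where C: "finite C" "span C = l"
    using finite_spanning_set_of_dim_pos[OF l] assms(3) by auto
  have F: "finite (B \<union> C)" "span (B \<union> C) = E'"
    using B C E'_eq by (auto simp: span_Un set_plus_def)
  let ?P = "proj_part E l"
  have "q_matroid scale E' (sum_rank E r l)"
  proof
    show "subspace E'" by fact
    show "\<exists>B. finite B \<and> span B = E'" using F by blast
  next
    fix A assume A: "subspace A" "A \<subseteq> E'"
    note P = proj_part_props[OF D A]
    show "0 \<le> sum_rank E r l A \<and> sum_rank E r l A \<le> int (dim A)"
      using R1[OF P(1,2)] dim_proj_le[OF D A F(1)] F(2)
      by (simp add: sum_rank_def)
  next
    fix A B assume AB: "subspace A" "subspace B" "B \<subseteq> E'" "A \<subseteq> B"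
    show "sum_rank E r l A \<le> sum_rank E r l B"
      unfolding sum_rank_def using AB
      by (intro R2 proj_mono[OF D] proj_part_props[OF D]) auto
  next
    fix A B assume A: "subspace A" "A \<subseteq> E'" and B: "subspace B" "B \<subseteq> E'"
    note PA = proj_part_props[OF D A] and PB = proj_part_props[OF D B]
    have AB: "subspace (A \<inter> B)" using A B by (intro subspace_inter)
    have "?P (A \<inter> B) \<subseteq> ?P A \<inter> ?P B"
      using A B AB by (intro Int_greatest proj_mono[OF D]) auto
    hence "r (?P (A \<inter> B)) \<le> r (?P A \<inter> ?P B)"
      using A B AB PA PB by (intro R2 subspace_inter proj_part_props(1)[OF D]) auto
    with R3[OF PA(1,2) PB(1,2)]
    show "sum_rank E r l (A + B) + sum_rank E r l (A \<inter> B) \<le> sum_rank E r l A + sum_rank E r l B"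
      by (simp add: sum_rank_def proj_sum[OF D A B])
  qed
  moreover have "\<exists>!A. subspace A \<and> A \<subseteq> E \<and> is_direct_sum (A' + l) A l"
    if "subspace A' \<and> A' \<subseteq> E'" for A'
    using that by (simp add: complement_iff[OF D])
  ultimately show ?thesis by blast
qed

end
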